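(* Let $n\ge1$ be a natural number. Define the double-indexed sequence $F_r(k)$ for integers $r,k\ge0$ by $F_r(0)=1$ for all $r$, and for $k\ge1$ $$F_r(k)=(2^n-r-k)\,F_r(k-1)+4\,(2^n-2r-1)\,F_{r+1}(k-1).$$ Then the Fermat number $F_n=2^{2^n}+1$ is given by $$F_n=\frac{F_0(2^{n-1})}{(2^n-1)(2^n-2)\cdots(2^{n-1})} .$$
   Context: Here $F_n$ (a single subscript, no argument) is the Fermat number, while $F_r(k)$ denotes the double-indexed sequence. The denominator is the product of all integers from $2^{n-1}$ to $2^n-1$ inclusive. *)

theory Defs
  imports Complex_Main
begin

definition fermat_number :: "nat \<Rightarrow> nat" where
  "fermat_number n = 2 ^ (2 ^ n) + 1"

text \<open>
  The sequence \<open>F\<^sub>r(k)\<close> for the fixed parameter \<open>n\<close>, written \<open>fermat_seq n r k\<close>. It takes values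
  in the integers because the coefficients \<open>2\<^sup>n - r - k\<close> and \<open>2\<^sup>n - 2r - 1\<close> may be negative.
\<close>

fun fermat_seq :: "nat \<Rightarrow> nat \<Rightarrow> nat \<Rightarrow> int" where
  "fermat_seq n r 0 = 1"
| "fermat_seq n r (Suc k) =
     (2 ^ n - int r - int (Suc k)) * fermat_seq n r k
     + 4 * (2 ^ n - 2 * int r - 1) * fermat_seq n (Suc r) k"

end

theory Submission
  imports Defs "HOL-Computational_Algebra.Formal_Power_Series"
begin

text \<open>
  Put \<open>N = 2\<^sup>n\<close> and \<open>a = (N - 1)/2\<close>. The series \<open>G\<^sub>r = (1 + X)\<^sup>a (1 + 9X)\<^bsup>a-r\<^esup>\<close> satisfies
  \<open>(1 + X) G\<^sub>r' = (2a - r) G\<^sub>r + 8 (a - r) G\<^bsub>r+1\<^esub>\<close>, which on coefficients is the defining recurrence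
  of \<open>F\<^sub>r(k)\<close>; hence \<open>F\<^sub>r(k) = k! [X\<^sup>k] G\<^sub>r\<close>. For \<open>r = 0\<close> and \<open>k = M = N/2\<close> the coefficient is a sum
  over \<open>j\<close> of products of two binomials with upper index \<open>M - 1/2\<close>, each of which is a constant
  multiple of \<open>binom (2M) (2j)\<close>, so it is the even part of a binomial expansion of \<open>(1 \<plusminus> 3)\<^bsup>2M\<^esup>\<close>.
\<close>

unbundle fps_syntax

text \<open>The series \<open>(1 + c X)^b\<close>, given by its coefficients so that
  \<open>b\<close> may be any field element.\<close>

definition fps_binomial_scaled :: "'a::field_char_0 \<Rightarrow> 'a \<Rightarrow> 'a fps" where
  "fps_binomial_scaled c b = Abs_fps (\<lambda>j. (b gchoose j) * c ^ j)"

lemma fps_binomial_scaled_step: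
  "fps_binomial_scaled c b = (1 + fps_const c * fps_X) * fps_binomial_scaled c (b - 1)"
proof (rule fps_ext)
  fix j
  show "fps_binomial_scaled c b $ j =
    ((1 + fps_const c * fps_X) * fps_binomial_scaled c (b - 1)) $ j"
  proof (cases j)
    case (Suc i)
    have "b gchoose Suc i = (b - 1 gchoose i) + (b - 1 gchoose Suc i)"
      using gbinomial_Suc_Suc[of "b - 1" i] by simp
    then show ?thesis
      by (simp add: Suc fps_binomial_scaled_def algebra_simps)
  qed (simp add: fps_binomial_scaled_def algebra_simps)
qed

lemma fps_deriv_binomial_scaled:
  "fps_deriv (fps_binomial_scaled c b) = fps_const (c * b) * fps_binomial_scaled c (b - 1)"
proof (rule fps_ext)
  fix j
  have "of_nat (Suc j) * (b gchoose Suc j) = b * (b - 1 gchoose j)"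
    by (rule gbinomial_absorption)
  then show "fps_deriv (fps_binomial_scaled c b) $ j =
    (fps_const (c * b) * fps_binomial_scaled c (b - 1)) $ j"
    by (simp add: fps_binomial_scaled_def del: of_nat_Suc)
qed

lemma fps_deriv_binomial_scaled_mult:
  fixes a b :: "'a::field_char_0"
  shows "(1 + fps_X) * fps_deriv (fps_binomial_scaled 1 a * fps_binomial_scaled 9 b) =
    fps_const (a + b) * (fps_binomial_scaled 1 a * fps_binomial_scaled 9 b) +
    fps_const (8 * b) * (fps_binomial_scaled 1 a * fps_binomial_scaled 9 (b - 1))"
proof -
  define A A' B B' :: "'a fps" where "A = fps_binomial_scaled 1 a"
    and "A' = fps_binomial_scaled 1 (a - 1)"
    and "B = fps_binomial_scaled 9 b" and "B' = fps_binomial_scaled 9 (b - 1)"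
  have A: "A = (1 + fps_X) * A'"
    using fps_binomial_scaled_step[of 1 a] by (simp add: A_def A'_def)
  have B: "B = (1 + 9 * fps_X) * B'"
    using fps_binomial_scaled_step[of 9 b] by (simp add: B_def B'_def numeral_fps_const)
  have dA: "fps_deriv A = fps_const a * A'"
    using fps_deriv_binomial_scaled[of 1 a] by (simp add: A_def A'_def)
  have dB: "fps_deriv B = 9 * fps_const b * B'"
    using fps_deriv_binomial_scaled[of 9 b]
    by (simp add: B_def B'_def numeral_fps_const)
  have "(1 + fps_X) * fps_deriv (A * B) =
    fps_const a * ((1 + fps_X) * A') * B + fps_const b * A * (9 + 9 * fps_X) * B'"
    by (simp add: dA dB algebra_simps)
  \<comment> \<open>Split \<open>9 + 9 X = (1 + 9 X) + 8\<close>: the first part turns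
    \<open>B'\<close> back into \<open>B\<close>, the remainder 8 leaves the term with lowered
    exponent.\<close>
  also have "\<dots> = fps_const a * A * B + fps_const b * A * B + 8 * fps_const b * A * B'"
    by (simp add: A[symmetric]) (simp add: B algebra_simps)
  also have "\<dots> = fps_const (a + b) * (A * B) + fps_const (8 * b) * (A * B')"
    by (simp add: algebra_simps numeral_fps_const flip: fps_const_add fps_const_mult)
  finally show ?thesis
    by (simp add: A_def B_def B'_def)
qed

lemma fermat_seq_eq_fps_nth:
  fixes n r k :: nat
  defines "a \<equiv> (2 ^ n - 1) / 2 :: real"
  shows "real_of_int (fermat_seq n r k) =
    fact k * (fps_binomial_scaled 1 a * fps_binomial_scaled 9 (a - real r)) $ k"
proof (induction k arbitrary: r)
  case 0
  then show ?case
    by (simp add: fps_binomial_scaled_def)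
next
  case (Suc k)
  define G where "G r = fps_binomial_scaled 1 a * fps_binomial_scaled 9 (a - real r)" for r
  have "(1 + fps_X) * fps_deriv (G r) =
    fps_const (2 * a - real r) * G r + fps_const (8 * (a - real r)) * G (Suc r)"
    using fps_deriv_binomial_scaled_mult[of a "a - real r"]
    by (simp add: G_def algebra_simps)
  then have "((1 + fps_X) * fps_deriv (G r)) $ k =
    (fps_const (2 * a - real r) * G r + fps_const (8 * (a - real r)) * G (Suc r)) $ k"
    by simp
  moreover have "((1 + fps_X) * fps_deriv (G r)) $ k =
    real (Suc k) * G r $ Suc k + real k * G r $ k"
    by (cases k) (simp_all add: distrib_right)
  ultimately have coeff: "real (Suc k) * G r $ Suc k =
    (2 * a - real r - real k) * G r $ k + 8 * (a - real r) * G (Suc r) $ k"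
    by (simp add: algebra_simps)
  have "fact (Suc k) * G r $ Suc k = fact k * (real (Suc k) * G r $ Suc k)"
    by (simp del: of_nat_Suc add: mult.commute mult.left_commute)
  also have "\<dots> =
    (2 * a - real r - real k) * (fact k * G r $ k) +
    8 * (a - real r) * (fact k * G (Suc r) $ k)"
    unfolding coeff by (simp only: distrib_left mult.assoc mult.left_commute)
  finally have "fact (Suc k) * G r $ Suc k =
    (2 * a - real r - real k) * (fact k * G r $ k) +
    8 * (a - real r) * (fact k * G (Suc r) $ k)" .
  \<comment> \<open>Since \<open>2 a = 2^n - 1\<close>, the coefficients agree:
    \<open>2 a - r - k = 2^n - r - (k + 1)\<close> and
    \<open>8 (a - r) = 4 (2^n - 2 r - 1)\<close>.\<close>
  moreover have "real_of_int (fermat_seq n r (Suc k)) =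
    (2 * a - real r - real k) * (fact k * G r $ k) +
    8 * (a - real r) * (fact k * G (Suc r) $ k)"
    unfolding G_def Suc.IH[symmetric] by (simp add: a_def field_simps)
  ultimately show ?case
    unfolding G_def by simp
qed

text \<open>The falling factorial of \<open>M - 1/2\<close> is \<open>(2M - 1)(2M - 3)...\<close>
  over a power of 2, and such a product of odd numbers is a quotient of factorials. Denominators are
  cleared for the induction.\<close>

lemma gbinomial_half_integer:
  assumes "j \<le> M"
  shows "(real M - 1 / 2 gchoose j) * (4 ^ j * fact j * fact M * fact (2 * (M - j))) =
    fact (2 * M) * fact (M - j)"
  using assms
proof (induction j)
  case (Suc j)
  define i where "i = M - Suc j"
  have M: "M - j = Suc i" "M - Suc j = i" "real M = real i + real j + 1"
    using Suc.prems by (auto simp: i_def)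
  define g where "g = (real M - 1 / 2 gchoose j)"
  have g: "(real M - 1 / 2 gchoose Suc j) * real (Suc j) = (real i + 1 / 2) * g"
    using gbinomial_mult_1[of "real M - 1 / 2" j] M(3)
    by (simp add: g_def algebra_simps)
  have "(real M - 1 / 2 gchoose Suc j) * (4 ^ Suc j * fact (Suc j) * fact M * fact (2 * i)) =
    ((real M - 1 / 2 gchoose Suc j) * real (Suc j)) * (4 ^ Suc j * fact j * fact M * fact (2 * i))"
    by (simp add: algebra_simps)
  \<comment> \<open>The extra factor \<open>i + 1\<close> completes the factorial:
    \<open>4 (i + 1/2)(i + 1) = (2i + 1)(2i + 2)\<close>.\<close>
  also have "\<dots> * real (Suc i) = g * (4 ^ j * fact j * fact M * fact (2 * Suc i))"
    unfolding g by (simp add: algebra_simps)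
  also have "\<dots> = fact (2 * M) * fact i * real (Suc i)"
    using Suc by (simp add: g_def M algebra_simps)
  finally show ?case
    unfolding M(2) by (metis mult_right_cancel of_nat_neq_0)
qed simp

text \<open>In the product of the two closed forms, \<open>j!\<close> and \<open>(M - j)!\<close>
  cancel; apart from \<open>(2j)! (2(M - j))!\<close> in the denominator, nothing depends on
  \<open>j\<close>.\<close>

lemma gbinomial_half_integer_mult:
  assumes "j \<le> M"
  shows "(real M - 1 / 2 gchoose j) * (real M - 1 / 2 gchoose (M - j)) =
    real (2 * M choose (2 * j)) * (fact (2 * M) / (4 ^ M * fact M ^ 2))"
proof -
  have 1: "(real M - 1 / 2 gchoose j) =
    fact (2 * M) * fact (M - j) / (4 ^ j * fact j * fact M * fact (2 * (M - j)))"
    using gbinomial_half_integer[OF assms] by (simp add: field_simps)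
  have 2: "(real M - 1 / 2 gchoose (M - j)) =
    fact (2 * M) * fact j / (4 ^ (M - j) * fact (M - j) * fact M * fact (2 * j))"
    using gbinomial_half_integer[of "M - j" M] assms by (simp add: field_simps)
  have 3: "real (2 * M choose (2 * j)) = fact (2 * M) / (fact (2 * j) * fact (2 * (M - j)))"
    using binomial_fact[of "2 * j" "2 * M", where 'a = real] assms
    by (simp add: diff_mult_distrib2)
  have "(4::real) ^ M = 4 ^ j * 4 ^ (M - j)"
    using assms by (simp flip: power_add)
  then show ?thesis
    unfolding 1 2 3 by (simp add: field_simps power2_eq_square)
qed

lemma sum_binomial_even:
  fixes x :: "'a::comm_ring_1"
  shows "2 * (\<Sum>j\<le>M. of_nat (2 * M choose (2 * j)) * (x ^ 2) ^ j) =
    (1 + x) ^ (2 * M) + (1 - x) ^ (2 * M)"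
proof -
  have "(1 + x) ^ (2 * M) + (1 - x) ^ (2 * M) =
    (\<Sum>i\<le>2 * M. of_nat (2 * M choose i) * (x ^ i + (- x) ^ i))"
    using binomial_ring[of x 1 "2 * M"] binomial_ring[of "- x" 1 "2 * M"]
    by (simp add: add.commute distrib_left flip: sum.distrib)
  \<comment> \<open>For odd \<open>i\<close> the powers of \<open>x\<close> and \<open>- x\<close>
    cancel, so only even indices remain.\<close>
  also have "\<dots> = (\<Sum>i\<in>(*) 2 ` {..M}. of_nat (2 * M choose i) * (x ^ i + (- x) ^ i))"
  proof (rule sum.mono_neutral_right)
    show "\<forall>i\<in>{..2 * M} - (*) 2 ` {..M}. of_nat (2 * M choose i) * (x ^ i + (- x) ^ i) = 0"
    proof
      fix i assume i: "i \<in> {..2 * M} - (*) 2 ` {..M}"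
      then have "odd i"
        by (auto elim!: evenE)
      then show "of_nat (2 * M choose i) * (x ^ i + (- x) ^ i) = 0"
        by simp
    qed
  qed auto
  also have "\<dots> = (\<Sum>j\<le>M. of_nat (2 * M choose (2 * j)) * (2 * (x ^ 2) ^ j))"
    by (simp add: sum.reindex inj_on_def power_mult)
  finally show ?thesis
    by (simp add: sum_distrib_left mult.left_commute)
qed

lemma fps_nth_binomial_scaled_half_integer:
  fixes M :: nat
  defines "a \<equiv> real M - 1 / 2"
  shows "(fps_binomial_scaled 1 a * fps_binomial_scaled 9 a) $ M =
    (4 ^ M + 1) * fact (2 * M) / (2 * fact M ^ 2)"
proof -
  have "(fps_binomial_scaled 1 a * fps_binomial_scaled 9 a) $ M =
    (\<Sum>j\<le>M. (a gchoose j) * 9 ^ j * (a gchoose (M - j)))"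
    \<comment> \<open>Swapping the factors attaches the power of 9 to \<open>j\<close> instead of
      \<open>M - j\<close>.\<close>
    unfolding mult.commute[of "fps_binomial_scaled 1 a"]
    by (simp add: fps_mult_nth fps_binomial_scaled_def atMost_atLeast0)
  also have "\<dots> =
    (\<Sum>j\<le>M. real (2 * M choose (2 * j)) * 9 ^ j) * (fact (2 * M) / (4 ^ M * fact M ^ 2))"
    unfolding sum_distrib_right
  proof (rule sum.cong)
    fix j assume "j \<in> {..M}"
    then show "(a gchoose j) * 9 ^ j * (a gchoose (M - j)) =
      real (2 * M choose (2 * j)) * 9 ^ j * (fact (2 * M) / (4 ^ M * fact M ^ 2))"
      using gbinomial_half_integer_mult[of j M] by (simp add: a_def mult.commute mult.left_commute)
  qed simp
  also have "(\<Sum>j\<le>M. real (2 * M choose (2 * j)) * 9 ^ j) = 4 ^ M * (4 ^ M + 1) / 2"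
  proof -
    \<comment> \<open>Take \<open>x = 3\<close>, as \<open>9 = 3^2\<close>.\<close>
    have "2 * (\<Sum>j\<le>M. real (2 * M choose (2 * j)) * 9 ^ j) = 4 ^ (2 * M) + (- 2) ^ (2 * M)"
      using sum_binomial_even[of M "3 :: real"] by simp
    also have "(4::real) ^ (2 * M) = 4 ^ M * 4 ^ M"
      by (simp only: mult_2 power_add)
    also have "(- 2 :: real) ^ (2 * M) = 4 ^ M"
      by (simp add: power_mult)
    finally show ?thesis
      by (simp add: distrib_left)
  qed
  finally show ?thesis
    by simp
qed

theorem theorem17:
  fixes n :: nat
  assumes "n \<ge> 1"
  shows "real (fermat_number n) =
    real_of_int (fermat_seq n 0 (2 ^ (n - 1))) / (\<Prod>j\<in>{2 ^ (n - 1)..2 ^ n - 1 :: nat}. real j)"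
proof -
  define M :: nat where "M = 2 ^ (n - 1)"
  have M: "2 ^ n = 2 * M" "M > 0"
    using assms by (simp_all add: M_def flip: power_Suc)
  have "(2 ^ n :: real) = 2 * real M"
    using M(1) by (metis of_nat_mult of_nat_numeral of_nat_power)
  then have a: "(2 ^ n - 1) / 2 = real M - 1 / 2"
    by simp
  have F: "real_of_int (fermat_seq n 0 M) = (4 ^ M + 1) * fact (2 * M) / (2 * fact M)"
    using fermat_seq_eq_fps_nth[of n 0 M] fps_nth_binomial_scaled_half_integer[of M]
    by (simp add: a power2_eq_square)
  \<comment> \<open>The denominator is \<open>(2M - 1)! / (M - 1)!\<close>. Extending both
    factorials by one factor, \<open>2M\<close> and \<open>M\<close>, makes it
    \<open>(2M)! / (2 M!)\<close>, which is the cofactor of \<open>4^M + 1\<close> in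
    \<open>F\<close>.\<close>
  have "(fact (2 * M - 1) :: real) = fact (M - 1) * (\<Prod>j\<in>{M..2 * M - 1}. real j)"
  proof -
    have "{1..2 * M - 1} = {1..M - 1} \<union> {M..2 * M - 1}"
      using M(2) by auto
    then show ?thesis
      by (simp add: fact_prod, subst prod.union_disjoint) auto
  qed
  moreover have "(fact (2 * M) :: real) = 2 * real M * fact (2 * M - 1)"
    "(fact M :: real) = real M * fact (M - 1)"
    using M(2) fact_reduce[of "2 * M", where 'a = real] fact_reduce[of M, where 'a = real] by simp_all
  ultimately have F': "real_of_int (fermat_seq n 0 M) =
    (4 ^ M + 1) * (\<Prod>j\<in>{M..2 * M - 1}. real j)"
    unfolding F using M(2) by (simp add: field_simps)
  have "(\<Prod>j\<in>{M..2 * M - 1}. real j) \<noteq> 0"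
    using M(2) by simp
  moreover have "real (fermat_number n) = 4 ^ M + 1"
    by (simp add: fermat_number_def M(1) power_mult)
  ultimately show ?thesis
    unfolding M(1) M_def[symmetric] F' by simp
qed

end
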